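(* Let $V$ be a finite set and let $\rho_1, \rho_2$ be permutations of $V$. Let $\rho_0 = \rho_2 \rho_1^{-1}$ (i.e.\ $\rho_0(i) = \rho_2(\rho_1^{-1}(i))$). Let $C(\rho_1,\rho_2) = (c_{i,j})_{i,j \in V}$ be the matrix with $c_{i,j} = \#\{ k \in \{1,2\} : \rho_k(i) = j\}$. Then $\det C(\rho_1,\rho_2) = 0$ if $\rho_0$ has at least one cycle of even length, and $\det C(\rho_1,\rho_2) = \operatorname{sign}(\rho_1) \cdot 2^{\mathrm{cl}(\rho_0)}$ otherwise, where $\mathrm{cl}(\rho_0)$ is the number of cycles of $\rho_0$ (fixed points counted as cycles of length $1$).
   Context: $C(\rho_1,\rho_2)$ is the adjacency matrix of the directed graph on $V$ with edges $i \to \rho_1(i)$ and $i \to \rho_2(i)$, where a coincidence $\rho_1(i) = \rho_2(i)$ gives entry $2$. The determinant is taken with rows and columns indexed by $V$ in the same order. $\operatorname{sign}$ denotes the sign of a permutation. *)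

theory Defs
  imports "Jordan_Normal_Form.Determinant" "HOL-Combinatorics.Orbits"
begin

definition perm_entry :: "('v \<Rightarrow> 'v) \<Rightarrow> ('v \<Rightarrow> 'v) \<Rightarrow> 'v \<Rightarrow> 'v \<Rightarrow> int" where
  "perm_entry \<rho>1 \<rho>2 i j = int (card {k \<in> {1, 2 :: nat}. (if k = 1 then \<rho>1 else \<rho>2) i = j})"

text \<open>The enumeration \<open>e\<close> lists the index set \<open>V\<close> (of cardinality \<open>n\<close>) as
  \<open>e 0, \<dots>, e (n - 1)\<close>; the same order is used for rows and columns.\<close>

definition perm_matrix :: "nat \<Rightarrow> (nat \<Rightarrow> 'v) \<Rightarrow> ('v \<Rightarrow> 'v) \<Rightarrow> ('v \<Rightarrow> 'v) \<Rightarrow> int mat" where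
  "perm_matrix n e \<rho>1 \<rho>2 = mat n n (\<lambda>(a, b). perm_entry \<rho>1 \<rho>2 (e a) (e b))"

text \<open>A cycle is represented by its underlying set, so its length is the cardinality of that set
  and a fixed point \<open>x\<close> contributes the cycle \<open>{x}\<close>.\<close>

definition perm_cycles :: "'v set \<Rightarrow> ('v \<Rightarrow> 'v) \<Rightarrow> 'v set set" where
  "perm_cycles V \<rho> = {S. S \<subseteq> V \<and> cyclic_on \<rho> S}"

end

theory Submission
  imports Defs "HOL-Combinatorics.Cycles"
begin

text \<open>Reindexing the Leibniz expansion by \<open>\<rho>1\<close> gives
  \<open>det C = sign \<rho>1 * (\<Sum>q. sign q * (\<Prod>k. [q k = \<rho>0 k] + [q k = k]))\<close>.
  Multiplying out the product, a choice of the first summand on a set \<open>S\<close> and of the second one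
  elsewhere survives only if \<open>S\<close> is a union of cycles of \<open>\<rho>0\<close>, and it then contributes the
  sign of the restriction of \<open>\<rho>0\<close> to \<open>S\<close>. The sum over all unions of cycles factors as
  \<open>\<Prod>C. 1 + (-1) ^ (card C - 1)\<close>, where \<open>C\<close> ranges over the cycles.\<close>

section \<open>Signs of the restrictions of a permutation to its cycles\<close>

text \<open>Each recursion step of \<open>cycle_of_list\<close> splits off one transposition. For
  the empty list the truncated exponent is 0, in agreement with the sign of the identity.\<close>

lemma sign_cycle_of_list:
  assumes "distinct cs"
  shows "sign (cycle_of_list cs) = (-1) ^ (length cs - 1)"
  using assms
proof (induction cs rule: cycle_of_list.induct)
  case (1 i j cs)
  have "sign (cycle_of_list (i # j # cs))
      = sign (Transposition.transpose i j) * sign (cycle_of_list (j # cs))"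
    by (simp add: sign_compose permutation_swap_id permutation_of_cycle)
  also have "\<dots> = (-1) ^ (length (i # j # cs) - 1)"
    using 1 by (simp add: sign_swap_id)
  finally show ?case .
qed auto

lemma perm_restrict_permutes_cyclic:
  assumes "f permutes V" "cyclic_on f C"
  shows "perm_restrict f C permutes C"
proof (rule bij_imp_permutes)
  have "inj_on f C"
    using permutes_inj[OF assms(1)] by (rule inj_on_subset) simp
  moreover have "f ` C \<subseteq> C"
    using cyclic_on_inI[OF assms(2)] by blast
  ultimately have "bij_betw f C C"
    using finite_cyclic_on[OF assms(2)] by (simp add: bij_betw_def endo_inj_surj)
  then show "bij_betw (perm_restrict f C) C C"
    by (rule bij_betw_cong[THEN iffD1, rotated]) (simp add: perm_restrict_simps)
qed (simp add: perm_restrict_simps)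

text \<open>The list \<open>support f a\<close> runs through the iterates of \<open>f\<close> at a
  point \<open>a\<close> of the cycle, so the restriction is the cycle given by that list, of length
  \<open>card C\<close>.\<close>

lemma sign_perm_restrict_cyclic:
  assumes "f permutes V" "finite V" "cyclic_on f C"
  shows "sign (perm_restrict f C) = (-1) ^ (card C - 1)"
proof -
  have perm: "permutation f"
    using assms(1,2) permutation_permutes by blast
  obtain a where a: "a \<in> C" "C = orbit f a"
    using assms(3) by (auto simp: cyclic_on_def)
  have set: "set (support f a) = C"
    unfolding support_set[OF perm] a(2) orbit_altdef_permutation[OF perm] by auto
  have "perm_restrict f C = cycle_of_list (support f a)"
  proof
    fix x
    show "perm_restrict f C x = cycle_of_list (support f a) x"
      using cycle_restrict[OF perm, of x a] id_outside_supp[of x "support f a"]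
      unfolding set perm_restrict_def by simp
  qed
  moreover have "length (support f a) = card C"
    using distinct_card[OF cycle_of_permutation[OF perm, of a]] unfolding set by simp
  ultimately show ?thesis
    using sign_cycle_of_list[OF cycle_of_permutation[OF perm, of a]] by simp
qed

section \<open>Unions of cycles\<close>

text \<open>A cycle is the orbit of each of its points, so a common point forces equality.\<close>

lemma perm_cycles_disjoint:
  assumes "C \<in> perm_cycles V f" "D \<in> perm_cycles V f" "C \<noteq> D"
  shows "C \<inter> D = {}"
proof (rule ccontr)
  assume "C \<inter> D \<noteq> {}"
  then obtain x where "x \<in> C" "x \<in> D"
    by blast
  then have "orbit f x = C" "orbit f x = D"
    using assms(1,2) by (auto simp: perm_cycles_def orbit_cyclic_eq3)
  with assms(3) show False
    by simp
qed

lemma finite_perm_cycles: "finite V \<Longrightarrow> finite (perm_cycles V f)"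
  unfolding perm_cycles_def by simp

text \<open>Cycles are pairwise disjoint, so adding one to \<open>K\<close> composes the restriction
  with one more cyclic factor, and \<open>sign\<close> is multiplicative. Both claims go through one
  induction because multiplicativity needs the factors to be permutations.\<close>

lemma perm_restrict_Union_cycles:
  assumes "f permutes V" "finite V" "K \<subseteq> perm_cycles V f"
  shows "perm_restrict f (\<Union>K) permutes \<Union>K
    \<and> sign (perm_restrict f (\<Union>K)) = (\<Prod>C\<in>K. (-1) ^ (card C - 1))"
proof -
  have "finite K"
    using assms(3) finite_perm_cycles[OF assms(2)] by (rule finite_subset)
  then show ?thesis
    using assms(3)
  proof (induction K rule: finite_induct)
    case empty
    have "perm_restrict f {} = id"
      by (simp add: perm_restrict_def fun_eq_iff)
    then show ?case
      by (simp only: Union_empty prod.empty permutes_id sign_id)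
  next
    case (insert C K)
    have C: "C \<subseteq> V" "cyclic_on f C"
      using insert.prems by (auto simp: perm_cycles_def)
    have sub: "\<Union>K \<subseteq> V"
      using insert.prems by (auto simp: perm_cycles_def)
    have pC: "perm_restrict f C permutes C"
      using assms(1) C(2) by (rule perm_restrict_permutes_cyclic)
    have pK: "perm_restrict f (\<Union>K) permutes \<Union>K"
      using insert by simp
    have "C \<inter> D = {}" if "D \<in> K" for D
      using perm_cycles_disjoint[of C V f D] insert.prems insert.hyps that by blast
    then have "C \<inter> \<Union>K = {}"
      by blast
    then have eq: "perm_restrict f (\<Union>(insert C K)) = perm_restrict f C \<circ> perm_restrict f (\<Union>K)"
      using perm_restrict_union[OF pC pK] by simp
    have "perm_restrict f (\<Union>(insert C K)) permutes \<Union>(insert C K)"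
      unfolding eq using pC pK
      by (intro permutes_compose) (auto intro: permutes_subset)
    moreover have "permutation (perm_restrict f C)" "permutation (perm_restrict f (\<Union>K))"
      using pC pK finite_subset[OF C(1) assms(2)] finite_subset[OF sub assms(2)]
      by (auto simp: permutation_permutes)
    then have "sign (perm_restrict f (\<Union>(insert C K)))
        = (-1) ^ (card C - 1) * sign (perm_restrict f (\<Union>K))"
      unfolding eq using sign_perm_restrict_cyclic[OF assms(1,2) C(2)] by (simp add: sign_compose)
    ultimately show ?case
      using insert by simp
  qed
qed

text \<open>If \<open>f x\<close> left \<open>S\<close>, the restriction would fix
  \<open>f x\<close> and also send \<open>x\<close> to it, against injectivity.\<close>

lemma perm_restrict_permutes_imp_invariant:
  assumes "perm_restrict f S permutes V" "x \<in> S"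
  shows "f x \<in> S"
proof (rule ccontr)
  assume "f x \<notin> S"
  then have "perm_restrict f S (f x) = perm_restrict f S x"
    using assms(2) by (simp add: perm_restrict_simps)
  then have "f x = x"
    using permutes_inj[OF assms(1)] by (simp add: inj_eq)
  with \<open>f x \<notin> S\<close> assms(2) show False
    by simp
qed

text \<open>The inverse collects the cycles contained in \<open>S\<close>. It recovers
  \<open>K\<close> because cycles are nonempty and disjoint, and it recovers \<open>S\<close>
  because \<open>S\<close> is closed under \<open>f\<close> and so contains the orbit of each of its
  points.\<close>

lemma bij_betw_Union_perm_cycles:
  assumes "f permutes V" "finite V"
  shows "bij_betw Union (Pow (perm_cycles V f)) {S. S \<subseteq> V \<and> perm_restrict f S permutes V}"
proof (rule bij_betw_byWitness[where f' = "\<lambda>S. {C \<in> perm_cycles V f. C \<subseteq> S}"])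
  show "\<forall>K\<in>Pow (perm_cycles V f). {C \<in> perm_cycles V f. C \<subseteq> \<Union>K} = K"
  proof (intro ballI equalityI subsetI)
    fix K C assume K: "K \<in> Pow (perm_cycles V f)" and C: "C \<in> {C \<in> perm_cycles V f. C \<subseteq> \<Union>K}"
    then have "C \<noteq> {}"
      by (auto simp: perm_cycles_def cyclic_on_alldef)
    then obtain D where "D \<in> K" "C \<inter> D \<noteq> {}"
      using C by blast
    then show "C \<in> K"
      using perm_cycles_disjoint[of C V f D] K C by blast
  qed auto
  show "\<forall>S\<in>{S. S \<subseteq> V \<and> perm_restrict f S permutes V}. \<Union>{C \<in> perm_cycles V f. C \<subseteq> S} = S"
  proof (intro ballI equalityI subsetI)
    fix S x assume S: "S \<in> {S. S \<subseteq> V \<and> perm_restrict f S permutes V}" and x: "x \<in> S"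
    have invariant: "f y \<in> S" if "y \<in> S" for y
      using perm_restrict_permutes_imp_invariant[of f S V y] S that by simp
    have "orbit f x \<subseteq> S"
    proof
      fix y assume "y \<in> orbit f x"
      then show "y \<in> S"
        by induct (simp_all add: invariant x)
    qed
    moreover have "cyclic_on f (orbit f x)"
      using assms by (rule cyclic_on_orbit)
    moreover have "x \<in> orbit f x"
      using assms by (intro permutation_self_in_orbit) (auto simp: permutation_permutes)
    ultimately show "x \<in> \<Union>{C \<in> perm_cycles V f. C \<subseteq> S}"
      using S by (auto simp: perm_cycles_def)
  qed auto
  show "Union ` Pow (perm_cycles V f) \<subseteq> {S. S \<subseteq> V \<and> perm_restrict f S permutes V}"
  proof clarify
    fix K assume K: "K \<subseteq> perm_cycles V f"
    then have "\<Union>K \<subseteq> V"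
      by (auto simp: perm_cycles_def)
    then show "\<Union>K \<subseteq> V \<and> perm_restrict f (\<Union>K) permutes V"
      using perm_restrict_Union_cycles[OF assms K] by (blast intro: permutes_subset)
  qed
qed auto

section \<open>The signed sum as a product over cycles\<close>

lemma prod_of_bool:
  assumes "finite A"
  shows "(\<Prod>x\<in>A. of_bool (P x) :: 'a :: comm_semiring_1) = of_bool (\<forall>x\<in>A. P x)"
  using assms by (induction A rule: finite_induct) auto

lemma sum_sign_prod_cycles:
  assumes "f permutes V" "finite V"
  shows "(\<Sum>q | q permutes V. sign q * (\<Prod>k\<in>V. of_bool (q k = f k) + of_bool (q k = k)))
    = (\<Prod>C\<in>perm_cycles V f. 1 + (-1) ^ (card C - 1))"
proof -
  let ?P = "{q. q permutes V}"
  have fin: "finite ?P"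
    using assms(2) by (rule finite_permutations)
  \<comment> \<open>\<open>S\<close> is the set of points at which the first summand is chosen. Both
    \<open>q\<close> and the restriction are the identity outside \<open>V\<close>, so agreement on
    \<open>V\<close> already gives equality of functions.\<close>
  have expand: "(\<Prod>k\<in>V. of_bool (q k = f k) + of_bool (q k = k) :: int)
      = (\<Sum>S\<in>Pow V. of_bool (q = perm_restrict f S))" if "q permutes V" for q
  proof -
    have "(\<Prod>k\<in>V. of_bool (q k = f k) + of_bool (q k = k) :: int)
        = (\<Sum>S\<in>Pow V. (\<Prod>k\<in>S. of_bool (q k = f k)) * (\<Prod>k\<in>V - S. of_bool (q k = k)))"
      using assms(2) by (rule prod_add)
    also have "\<dots> = (\<Sum>S\<in>Pow V. of_bool (q = perm_restrict f S))"
    proof (rule sum.cong[OF refl])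
      fix S assume S: "S \<in> Pow V"
      have "(\<forall>k\<in>S. q k = f k) \<and> (\<forall>k\<in>V - S. q k = k) \<longleftrightarrow> q = perm_restrict f S"
        using S permutes_not_in[OF that] unfolding perm_restrict_def fun_eq_iff
        by (auto split: if_splits)
      moreover have "finite S" "finite (V - S)"
        using S assms(2) by (auto intro: finite_subset)
      ultimately show "(\<Prod>k\<in>S. of_bool (q k = f k)) * (\<Prod>k\<in>V - S. of_bool (q k = k))
          = (of_bool (q = perm_restrict f S) :: int)"
        by (simp add: prod_of_bool flip: of_bool_conj)
    qed
    finally show ?thesis .
  qed
  have "(\<Sum>q\<in>?P. sign q * (\<Prod>k\<in>V. of_bool (q k = f k) + of_bool (q k = k)))
      = (\<Sum>q\<in>?P. \<Sum>S\<in>Pow V. sign q * of_bool (q = perm_restrict f S))"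
    by (rule sum.cong) (simp_all add: expand sum_distrib_left)
  also have "\<dots> = (\<Sum>S\<in>Pow V. \<Sum>q\<in>?P. sign q * of_bool (q = perm_restrict f S))"
    by (rule sum.swap)
  \<comment> \<open>For fixed \<open>S\<close> at most one \<open>q\<close> contributes, namely the
    restriction itself, provided that it permutes \<open>V\<close>.\<close>
  also have "\<dots> = (\<Sum>S\<in>Pow V. if perm_restrict f S permutes V then sign (perm_restrict f S) else 0)"
  proof (rule sum.cong[OF refl])
    fix S
    have "(\<Sum>q\<in>?P. sign q * of_bool (q = perm_restrict f S))
        = (\<Sum>q\<in>?P. if q = perm_restrict f S then sign q else 0)"
      by (rule sum.cong) auto
    then show "(\<Sum>q\<in>?P. sign q * of_bool (q = perm_restrict f S))
        = (if perm_restrict f S permutes V then sign (perm_restrict f S) else 0)"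
      using fin by simp
  qed
  also have "\<dots> = (\<Sum>S | S \<subseteq> V \<and> perm_restrict f S permutes V. sign (perm_restrict f S))"
    using assms(2) by (intro sum.mono_neutral_cong_right) auto
  also have "\<dots> = (\<Sum>K\<in>Pow (perm_cycles V f). sign (perm_restrict f (\<Union>K)))"
    using bij_betw_Union_perm_cycles[OF assms] by (rule sum.reindex_bij_betw[symmetric])
  also have "\<dots> = (\<Sum>K\<in>Pow (perm_cycles V f). \<Prod>C\<in>K. (-1) ^ (card C - 1))"
    using perm_restrict_Union_cycles[OF assms] by (intro sum.cong) auto
  \<comment> \<open>This is \<open>prod_add\<close> read backwards: cycles outside \<open>K\<close>
    contribute the factor 1.\<close>
  also have "\<dots> = (\<Prod>C\<in>perm_cycles V f. (-1) ^ (card C - 1) + 1)"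
    using finite_perm_cycles[OF assms(2)] by (subst prod_add) auto
  finally show ?thesis
    by (simp add: add.commute)
qed

section \<open>The determinant\<close>

lemma perm_entry_eq: "perm_entry \<rho>1 \<rho>2 i j = of_bool (\<rho>2 i = j) + of_bool (\<rho>1 i = j)"
proof -
  have "{k \<in> {1, 2 :: nat}. (if k = 1 then \<rho>1 else \<rho>2) i = j}
      = (if \<rho>1 i = j then {1} else {}) \<union> (if \<rho>2 i = j then {2} else {})"
    by auto
  then show ?thesis
    unfolding perm_entry_def by simp
qed

text \<open>The Leibniz formula on indices is carried over to \<open>V\<close> by conjugating
  permutations with \<open>e\<close>, which preserves signs. Hence the value does not depend on the
  enumeration.\<close>

lemma det_mat_enumeration:
  fixes A :: "'v \<Rightarrow> 'v \<Rightarrow> 'a :: comm_ring_1"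
  assumes "bij_betw e {..<n} V"
  shows "det (mat n n (\<lambda>(a, b). A (e a) (e b)))
    = (\<Sum>p | p permutes V. of_int (sign p) * (\<Prod>i\<in>V. A i (p i)))"
proof -
  let ?N = "{..<n}"
  \<comment> \<open>The conjugate of \<open>p\<close> by \<open>e\<close>, extended by the identity
    outside \<open>V\<close>.\<close>
  let ?m = "\<lambda>p x. if x \<in> V then e (p (inv_into ?N e x)) else x"
  have inj: "inj_on e ?N" and V: "e ` ?N = V"
    using assms by (auto simp: bij_betw_def)
  have m: "?m p = map_permutation ?N e p" for p
    by (auto simp: map_permutation_def V restrict_id_def)
  have "det (mat n n (\<lambda>(a, b). A (e a) (e b)))
      = (\<Sum>p | p permutes ?N. of_int (sign p) * (\<Prod>a\<in>?N. A (e a) (e (p a))))"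
  proof -
    have "(\<Prod>a\<in>?N. mat n n (\<lambda>(a, b). A (e a) (e b)) $$ (a, p a))
        = (\<Prod>a\<in>?N. A (e a) (e (p a)))" if "p permutes ?N" for p
      using permutes_in_image[OF that] by (intro prod.cong) auto
    then show ?thesis
      by (subst det_def'[of _ n]) (simp_all add: atLeast0LessThan)
  qed
  also have "\<dots> = (\<Sum>p | p permutes ?N. of_int (sign (?m p)) * (\<Prod>i\<in>V. A i (?m p i)))"
  proof (rule sum.cong[OF refl])
    fix p assume "p \<in> {p. p permutes ?N}"
    then have "sign (?m p) = sign p"
      unfolding m by (intro sign_map_permutation inj) auto
    moreover have "(\<Prod>i\<in>V. A i (?m p i)) = (\<Prod>a\<in>?N. A (e a) (e (p a)))"
      by (subst prod.reindex_bij_betw[OF assms, symmetric])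
        (use V in \<open>auto intro!: prod.cong simp: inv_into_f_f[OF inj]\<close>)
    ultimately show "of_int (sign p) * (\<Prod>a\<in>?N. A (e a) (e (p a)))
        = of_int (sign (?m p)) * (\<Prod>i\<in>V. A i (?m p i))"
      by simp
  qed
  also have "\<dots> = (\<Sum>p | p permutes V. of_int (sign p) * (\<Prod>i\<in>V. A i (p i)))"
    using bij_betw_permutations[OF assms] by (rule sum.reindex_bij_betw)
  finally show ?thesis .
qed

theorem theorem2p11:
  fixes V :: "'v set" and \<rho>0 \<rho>1 \<rho>2 :: "'v \<Rightarrow> 'v" and e :: "nat \<Rightarrow> 'v"
  assumes "finite V"
    and "\<rho>1 permutes V"
    and "\<rho>2 permutes V"
    and "\<rho>0 = \<rho>2 \<circ> inv_into UNIV \<rho>1"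
    and "bij_betw e {..<card V} V"
  shows "det (perm_matrix (card V) e \<rho>1 \<rho>2) =
    (if \<exists>S \<in> perm_cycles V \<rho>0. even (card S) then 0
     else sign \<rho>1 * 2 ^ card (perm_cycles V \<rho>0))"
proof -
  have \<rho>0: "\<rho>0 permutes V"
    unfolding assms(4) using assms(2,3) by (intro permutes_compose permutes_inv)
  have \<rho>0_\<rho>1: "\<rho>0 (\<rho>1 i) = \<rho>2 i" for i
    unfolding assms(4) using permutes_inverses(2)[OF assms(2)] by simp
  let ?b = "\<lambda>q k. of_bool (q k = \<rho>0 k) + of_bool (q k = k) :: int"
  have "det (perm_matrix (card V) e \<rho>1 \<rho>2)
      = (\<Sum>p | p permutes V. sign p * (\<Prod>i\<in>V. perm_entry \<rho>1 \<rho>2 i (p i)))"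
    unfolding perm_matrix_def by (subst det_mat_enumeration[OF assms(5)]) simp
  \<comment> \<open>The substitution \<open>p = q \<circ> \<rho>1\<close> makes each entry a
    function of \<open>k = \<rho>1 i\<close>: since \<open>\<rho>2 i = \<rho>0 k\<close>, it counts
    whether \<open>q k\<close> equals \<open>\<rho>0 k\<close> and whether it equals
    \<open>k\<close>.\<close>
  also have "\<dots> = (\<Sum>q | q permutes V. sign (q \<circ> \<rho>1) * (\<Prod>i\<in>V. perm_entry \<rho>1 \<rho>2 i ((q \<circ> \<rho>1) i)))"
    using assms(2) by (rule sum_permutations_compose_right)
  also have "\<dots> = (\<Sum>q | q permutes V. sign \<rho>1 * (sign q * (\<Prod>k\<in>V. ?b q k)))"
  proof (rule sum.cong[OF refl])
    fix q assume "q \<in> {q. q permutes V}"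
    then have "sign (q \<circ> \<rho>1) = sign q * sign \<rho>1"
      using assms(1,2) permutation_permutes by (intro sign_compose) blast+
    moreover have "(\<Prod>i\<in>V. perm_entry \<rho>1 \<rho>2 i ((q \<circ> \<rho>1) i)) = (\<Prod>i\<in>V. ?b q (\<rho>1 i))"
      by (simp add: perm_entry_eq \<rho>0_\<rho>1 eq_commute[of "q (\<rho>1 _)"])
    moreover have "\<dots> = (\<Prod>k\<in>V. ?b q k)"
      using permutes_imp_bij[OF assms(2)] by (rule prod.reindex_bij_betw)
    ultimately show "sign (q \<circ> \<rho>1) * (\<Prod>i\<in>V. perm_entry \<rho>1 \<rho>2 i ((q \<circ> \<rho>1) i))
        = sign \<rho>1 * (sign q * (\<Prod>k\<in>V. ?b q k))"
      by simp
  qed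
  also have "\<dots> = sign \<rho>1 * (\<Prod>C\<in>perm_cycles V \<rho>0. 1 + (-1) ^ (card C - 1))"
    using sum_sign_prod_cycles[OF \<rho>0 assms(1)] by (simp flip: sum_distrib_left)
  also have "\<dots> = (if \<exists>S \<in> perm_cycles V \<rho>0. even (card S) then 0
     else sign \<rho>1 * 2 ^ card (perm_cycles V \<rho>0))"
  proof -
    have "1 + (-1) ^ (card C - 1) = (if even (card C) then 0 else 2 :: int)"
      if "C \<in> perm_cycles V \<rho>0" for C
    proof -
      \<comment> \<open>Positivity keeps the subtraction in the exponent from truncating; at
        cardinality 0, which is even, the factor would be 2 instead of 0.\<close>
      have "card C > 0"
        using that finite_cyclic_on[of \<rho>0 C]
        by (auto simp: perm_cycles_def card_gt_0_iff cyclic_on_def)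
      then show ?thesis
        by (cases "card C") auto
    qed
    then have "(\<Prod>C\<in>perm_cycles V \<rho>0. 1 + (-1) ^ (card C - 1))
        = (\<Prod>C\<in>perm_cycles V \<rho>0. if even (card C) then 0 else 2 :: int)"
      by (rule prod.cong[OF refl])
    then show ?thesis
      using finite_perm_cycles[OF assms(1), of \<rho>0] by (auto simp: prod_zero)
  qed
  finally show ?thesis .
qed

end
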